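(* Let $A$ be an idiom. Then for every inflator $d\in I(A)$, $$O_{d(\underline{0})}=t(d).$$
   Context: An idiom is a complete modular lattice $A$ with top $\bar{1}$ and bottom $\underline{0}$ that is meet-continuous: $a\wedge\bigvee X=\bigvee\{a\wedge x\mid x\in X\}$ for all $a\in A$ and all directed $X\subseteq A$. An inflator on $A$ is a monotone map $d\colon A\to A$ with $a\le d(a)$ for all $a\in A$. $I(A)$ is the set of all inflators, ordered pointwise; it is a complete lattice whose infima are computed pointwise. Its top is $\bar{d}$, where $\bar{d}(a)=\bar{1}$ for all $a$, and its bottom is $d_{\underline{0}}=\mathrm{id}_A$. The product of inflators is composition: $(zd)(a)=z(d(a))$. The totalizer of $d\in I(A)$ is $t(d)=\bigwedge\{z\in I(A)\mid zd=\bar{d}\}$. For $b\in A$, the inflator $O_b$ is defined by $O_b(a)=\bar{1}$ if $a\ge b$, and $O_b(a)=a$ otherwise. *)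

theory Defs
  imports Main
begin

definition (in ord) directed :: "'a set \<Rightarrow> bool" where
  "directed X \<longleftrightarrow> X \<noteq> {} \<and> (\<forall>x\<in>X. \<forall>y\<in>X. \<exists>z\<in>X. x \<le> z \<and> y \<le> z)"

class idiom = complete_lattice +
  assumes modular: "a \<le> c \<Longrightarrow> sup a (inf b c) = inf (sup a b) c"
    and meet_continuous: "directed X \<Longrightarrow> inf a (Sup X) = Sup ((\<lambda>x. inf a x) ` X)"

typedef (overloaded) ('a :: idiom) inflator = "{d :: 'a \<Rightarrow> 'a. mono d \<and> (\<forall>a. a \<le> d a)}"
  morphisms inflate Inflator
  by (rule exI[of _ id]) (simp add: mono_def)

setup_lifting type_definition_inflator

instantiation inflator :: (idiom) complete_lattice
begin

lift_definition less_eq_inflator :: "'a inflator \<Rightarrow> 'a inflator \<Rightarrow> bool"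
  is "\<lambda>d z. \<forall>a. d a \<le> z a" .

definition less_inflator :: "'a inflator \<Rightarrow> 'a inflator \<Rightarrow> bool" where
  "less_inflator d z \<longleftrightarrow> d \<le> z \<and> \<not> z \<le> d"

lift_definition top_inflator :: "'a inflator" is "\<lambda>_. top"
  by (simp add: mono_def)

lift_definition bot_inflator :: "'a inflator" is "\<lambda>a. a"
  by (simp add: mono_def)

lift_definition inf_inflator :: "'a inflator \<Rightarrow> 'a inflator \<Rightarrow> 'a inflator"
  is "\<lambda>d z a. inf (d a) (z a)"
  by (auto simp: mono_def intro: le_infI1 le_infI2)

lift_definition sup_inflator :: "'a inflator \<Rightarrow> 'a inflator \<Rightarrow> 'a inflator"
  is "\<lambda>d z a. sup (d a) (z a)"
  by (auto simp: mono_def intro: le_supI1 le_supI2)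

lift_definition Inf_inflator :: "'a inflator set \<Rightarrow> 'a inflator"
  is "\<lambda>D a. INF d\<in>D. d a"
  by (auto simp: mono_def intro!: INF_greatest intro: INF_lower2)

text \<open>The join with \<open>a\<close> only matters when \<open>D\<close> is empty; it makes the value of the
  empty supremum the identity.\<close>

lift_definition Sup_inflator :: "'a inflator set \<Rightarrow> 'a inflator"
  is "\<lambda>D a. sup a (SUP d\<in>D. d a)"
  by (auto simp: mono_def intro!: SUP_least intro: le_supI1 le_supI2[OF SUP_upper2])

instance
proof
  fix x y z :: "'a inflator" and D :: "'a inflator set"
  show "x < y \<longleftrightarrow> x \<le> y \<and> \<not> y \<le> x" by (rule less_inflator_def)
  show "x \<le> x" by transfer simp
  show "x \<le> y \<Longrightarrow> y \<le> z \<Longrightarrow> x \<le> z" by transfer (blast intro: order_trans)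
  show "x \<le> y \<Longrightarrow> y \<le> x \<Longrightarrow> x = y" by transfer (auto intro: antisym)
  show "inf x y \<le> x" by transfer simp
  show "inf x y \<le> y" by transfer simp
  show "x \<le> y \<Longrightarrow> x \<le> z \<Longrightarrow> x \<le> inf y z" by transfer simp
  show "x \<le> sup x y" by transfer simp
  show "y \<le> sup x y" by transfer simp
  show "y \<le> x \<Longrightarrow> z \<le> x \<Longrightarrow> sup y z \<le> x" by transfer simp
  show "x \<in> D \<Longrightarrow> Inf D \<le> x" by transfer (auto intro: INF_lower)
  show "(\<And>x. x \<in> D \<Longrightarrow> z \<le> x) \<Longrightarrow> z \<le> Inf D" by transfer (auto intro!: INF_greatest)
  show "x \<in> D \<Longrightarrow> x \<le> Sup D" by transfer (auto intro!: le_supI2 SUP_upper)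
  show "(\<And>x. x \<in> D \<Longrightarrow> x \<le> z) \<Longrightarrow> Sup D \<le> z" by transfer (auto intro!: SUP_least)
  show "Inf {} = (top :: 'a inflator)" by transfer simp
  show "Sup {} = (bot :: 'a inflator)" by transfer simp
qed

end

instantiation inflator :: (idiom) times
begin

lift_definition times_inflator :: "'a inflator \<Rightarrow> 'a inflator \<Rightarrow> 'a inflator"
  is "\<lambda>z d a. z (d a)"
  by (auto simp: mono_def intro: order_trans)

instance ..

end

definition totalizer :: "'a :: idiom inflator \<Rightarrow> 'a inflator" where
  "totalizer d = Inf {z. z * d = top}"

lift_definition O_inflator :: "'a :: idiom \<Rightarrow> 'a inflator"
  is "\<lambda>b a. if b \<le> a then top else a"
  by (auto simp: mono_def intro: order_trans)

end

theory Submission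
  imports Defs
begin

text \<open>Every value of \<open>d\<close> lies above \<open>d \<bottom>\<close>, so a monotone \<open>z\<close> sends all of them to the top as soon
  as it sends \<open>d \<bottom>\<close> there. The condition \<open>z * d = \<top>\<close> therefore depends on one value of \<open>z\<close> only
  (\<open>times_eq_top_iff\<close>). An inflator that takes \<open>b\<close> to the top must by monotonicity take everything
  above \<open>b\<close> to the top, while elsewhere it is only forced to be inflationary; \<open>O_inflator b\<close> does
  exactly this much (\<open>O_inflator_le_iff\<close>). Hence the set \<open>{z. z * d = \<top>}\<close> is the principal filter
  generated by \<open>O_inflator (d \<bottom>)\<close>, whose infimum is its generator.\<close>

lemma times_eq_top_iff:
  "z * d = top \<longleftrightarrow> inflate z (inflate d bot) = top"
proof transfer
  fix z d :: "'a \<Rightarrow> 'a"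
  assume "mono z \<and> (\<forall>a. a \<le> z a)" and "mono d \<and> (\<forall>a. a \<le> d a)"
  then have "z (d bot) \<le> z (d a)" for a
    by (simp add: monoD)
  then show "(\<lambda>a. z (d a)) = (\<lambda>_. top) \<longleftrightarrow> z (d bot) = top"
    by (metis top.extremum_unique)
qed

lemma O_inflator_le_iff:
  "O_inflator b \<le> z \<longleftrightarrow> inflate z b = top"
proof transfer
  fix b and z :: "'a \<Rightarrow> 'a"
  assume z: "mono z \<and> (\<forall>a. a \<le> z a)"
  then have "z a = top" if "z b = top" "b \<le> a" for a
    using that by (metis monoD top.extremum_unique)
  then show "(\<forall>a. (if b \<le> a then top else a) \<le> z a) \<longleftrightarrow> z b = top"
    using z by (auto simp: top_unique)
qed

theorem theorem3p4:
  fixes d :: "'a :: idiom inflator"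
  shows "O_inflator (inflate d bot) = totalizer d"
proof -
  have "{z. z * d = top} = {O_inflator (inflate d bot)..}"
    by (auto simp: times_eq_top_iff O_inflator_le_iff)
  then show ?thesis
    by (auto simp: totalizer_def intro!: antisym Inf_lower Inf_greatest)
qed

end
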